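(* Let $X$ be a Banach space with the Daugavet property. Then every $T\in\operatorname{Lip}(X)$ for which $\operatorname{slope}(T)$ is an SCD set satisfies the Daugavet equation $\|\mathrm{Id}+T\|=1+\|T\|$.
   Context: $X$ is a real or complex Banach space. $X$ has the Daugavet property if every rank-one bounded linear operator $R:X\to X$ satisfies $\|\mathrm{Id}+R\|=1+\|R\|$. $\operatorname{Lip}(X)$ is the space of Lipschitz maps $T:X\to X$ (not necessarily linear) with the seminorm $\|T\|=\sup\left\{\frac{\|T(x_1)-T(x_2)\|}{\|x_1-x_2\|}:x_1\neq x_2\in X\right\}$ (formally modulo constants, or with $T(0)=0$); for linear operators this is the operator norm. $\operatorname{slope}(T):=\left\{\frac{T(x_1)-T(x_2)}{\|x_1-x_2\|}:x_1\neq x_2\in X\right\}$. A slice of a set $A\subset X$ is a non-empty set of the form $\{x\in A:\operatorname{Re}x^*(x)>\alpha\}$ with $x^*\in X^*\setminus\{0\}$, $\alpha\in\mathbb{R}$. A bounded set $A\subset X$ (not necessarily convex) is an SCD (slicely countably determined) set if there is a sequence $\{S_n:n\in\mathbb{N}\}$ of slices of $A$ which is determining, i.e. $A\subset\overline{\operatorname{conv}}(B)$ whenever $B\subset A$ intersects every $S_n$. *)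

theory Defs
  imports "HOL-Analysis.Analysis"
begin

text \<open>
  Scalars are handled uniformly: the space carries its real structure and norm from the type
  class, and the scalar multiplication of the ground field (\<open>real\<close> or \<open>complex\<close>) is an explicit
  argument \<open>sc\<close>.  A complex normed space is thus a real one with a compatible complex scalar
  multiplication; completeness depends only on the norm.
\<close>

definition complex_normed_space :: "(complex \<Rightarrow> 'a::real_normed_vector \<Rightarrow> 'a) \<Rightarrow> bool" where
  "complex_normed_space sc \<longleftrightarrow>
     vector_space sc \<and>
     (\<forall>r x. sc (complex_of_real r) x = r *\<^sub>R x) \<and>
     (\<forall>c x. norm (sc c x) = cmod c * norm x)"

text \<open>
  Boundedness is expressed over the underlying real structure, linearity over the ground field.
\<close>

definition bounded_operator ::
    "('k::real_normed_field \<Rightarrow> 'a::real_normed_vector \<Rightarrow> 'a) \<Rightarrow> ('a \<Rightarrow> 'a) \<Rightarrow> bool" where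
  "bounded_operator sc R \<longleftrightarrow> bounded_linear R \<and> Vector_Spaces.linear sc sc R"

definition dual_space ::
    "('k::real_normed_field \<Rightarrow> 'a::real_normed_vector \<Rightarrow> 'a) \<Rightarrow> ('a \<Rightarrow> 'k) set" where
  "dual_space sc = {f. bounded_linear f \<and> Vector_Spaces.linear sc (*) f}"

definition rank_one ::
    "('k::real_normed_field \<Rightarrow> 'a::real_normed_vector \<Rightarrow> 'a) \<Rightarrow> ('a \<Rightarrow> 'a) \<Rightarrow> bool" where
  "rank_one sc R \<longleftrightarrow> vector_space.dim sc (range R) = 1"

definition daugavet_property ::
    "('k::real_normed_field \<Rightarrow> 'a::real_normed_vector \<Rightarrow> 'a) \<Rightarrow> bool" where
  "daugavet_property sc \<longleftrightarrow>
     (\<forall>R. bounded_operator sc R \<longrightarrow> rank_one sc R \<longrightarrow>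
        onorm (\<lambda>x. x + R x) = 1 + onorm R)"

definition Lip :: "('a::real_normed_vector \<Rightarrow> 'a) set" where
  "Lip = {T. \<exists>L. L-lipschitz_on UNIV T}"

definition lip_norm :: "('a::real_normed_vector \<Rightarrow> 'a) \<Rightarrow> real" where
  "lip_norm T = Sup {norm (T x1 - T x2) / norm (x1 - x2) | x1 x2. x1 \<noteq> x2}"

definition slope :: "('a::real_normed_vector \<Rightarrow> 'a) \<Rightarrow> 'a set" where
  "slope T = {(T x1 - T x2) /\<^sub>R norm (x1 - x2) | x1 x2. x1 \<noteq> x2}"

text \<open>
  The argument \<open>re\<close> is the real part on the ground field: the identity on \<open>real\<close>, and \<open>Re\<close> on
  \<open>complex\<close>.
\<close>

definition is_slice ::
    "('k::real_normed_field \<Rightarrow> 'a::real_normed_vector \<Rightarrow> 'a) \<Rightarrow> ('k \<Rightarrow> real)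
      \<Rightarrow> 'a set \<Rightarrow> 'a set \<Rightarrow> bool" where
  "is_slice sc re A S \<longleftrightarrow>
     S \<noteq> {} \<and>
     (\<exists>f\<in>dual_space sc. \<exists>\<alpha>. f \<noteq> (\<lambda>x. 0) \<and> S = {x \<in> A. re (f x) > \<alpha>})"

definition determining :: "'a::real_normed_vector set \<Rightarrow> (nat \<Rightarrow> 'a set) \<Rightarrow> bool" where
  "determining A S \<longleftrightarrow>
     (\<forall>B\<subseteq>A. (\<forall>n. B \<inter> S n \<noteq> {}) \<longrightarrow> A \<subseteq> closure (convex hull B))"

definition SCD_set ::
    "('k::real_normed_field \<Rightarrow> 'a::real_normed_vector \<Rightarrow> 'a) \<Rightarrow> ('k \<Rightarrow> real)
      \<Rightarrow> 'a set \<Rightarrow> bool" where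
  "SCD_set sc re A \<longleftrightarrow>
     bounded A \<and> (\<exists>S. (\<forall>n. is_slice sc re A (S n)) \<and> determining A S)"

end

theory Submission imports Defs begin

text \<open>
  By Hahn--Banach separation, the Daugavet property says that for every \<open>v\<close> and \<open>\<epsilon> > 0\<close> the unit
  ball is the closed convex hull of the unit vectors \<open>y\<close> with \<open>\<parallel>v + y\<parallel> > \<parallel>v\<parallel> + 1 - \<epsilon>\<close>.  Moving along
  a polygonal path with edges in such directions shows that the increments of a real Lipschitz
  function in these directions already exhaust its slopes, so every slice of the slope set of \<open>T\<close>
  contains a difference quotient of \<open>T\<close> in such a direction.

  Given \<open>e\<close> in the slope set and a determining sequence of slices \<open>S\<^sub>n\<close>, choose inductively
  directions \<open>y\<^sub>n\<close> and difference quotients \<open>b\<^sub>n \<in> S\<^sub>n\<close> of \<open>T\<close> in direction \<open>y\<^sub>n\<close> such that the norm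
  is additive on \<open>e, y\<^sub>0, y\<^sub>1, \<dots>\<close> up to \<open>\<epsilon>\<close>; it then is so for convex combinations of the
  \<open>y\<^sub>n\<close> as well.  A convex combination of the \<open>b\<^sub>n\<close> is close to \<open>e\<close>, and the same combination of the
  \<open>y\<^sub>n + b\<^sub>n\<close> has norm almost \<open>\<parallel>e\<parallel> + 1\<close>, so the same holds for some \<open>\<parallel>y\<^sub>n + b\<^sub>n\<parallel>\<close>, which is a
  difference quotient of \<open>Id + T\<close>.
\<close>

section \<open>Sublinear functionals and separation\<close>

definition sublinear :: "('a::real_vector \<Rightarrow> real) \<Rightarrow> bool" where
  "sublinear p \<longleftrightarrow> (\<forall>x y. p (x + y) \<le> p x + p y) \<and> (\<forall>t\<ge>0. \<forall>x. p (t *\<^sub>R x) = t * p x)"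

lemma sublinear_add: "sublinear p \<Longrightarrow> p (x + y) \<le> p x + p y"
  and sublinear_scale: "sublinear p \<Longrightarrow> 0 \<le> t \<Longrightarrow> p (t *\<^sub>R x) = t * p x"
  by (auto simp: sublinear_def)

lemma sublinear_zero: "sublinear p \<Longrightarrow> p 0 = 0"
  using sublinear_scale[of p 0 0] by simp

lemma sublinear_lower: "sublinear p \<Longrightarrow> - p (- x) \<le> p x"
  using sublinear_add[of p x "- x"] sublinear_zero[of p] by simp

lemma sublinearI:
  assumes add: "\<And>x y. p (x + y) \<le> p x + p y"
    and le: "\<And>t x. 0 < t \<Longrightarrow> p (t *\<^sub>R x) \<le> t * p x"
    and zero: "p 0 = (0::real)"
  shows "sublinear p"
  unfolding sublinear_def
proof (intro conjI allI impI add)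
  fix t :: real and x assume "0 \<le> t"
  show "p (t *\<^sub>R x) = t * p x"
  proof (cases "t = 0")
    case False
    with \<open>0 \<le> t\<close> have t: "0 < t" by simp
    have "p x \<le> inverse t * p (t *\<^sub>R x)"
      using le[of "inverse t" "t *\<^sub>R x"] t by simp
    then have "t * p x \<le> p (t *\<^sub>R x)"
      using t by (simp add: field_simps)
    with le[OF t, of x] show ?thesis by simp
  qed (simp add: zero)
qed

text \<open>Any sublinear functional below \<open>q\<close> that is at most \<open>- d\<close> on
  \<open>- K\<close> satisfies p(x) \<le> p(x + t k) + t p(- k) \<le> q(x + t k) - t d. The infimum
  of the right-hand side over t \<ge> 0 and k in \<open>K\<close> is therefore the largest
  candidate. A singleton \<open>K\<close> serves minimality in the Hahn-Banach argument, a translate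
  of \<open>- C\<close> serves separation.\<close>

lemma sublinear_tilt:
  assumes q: "sublinear q" and K: "convex K" "K \<noteq> {}"
    and d: "\<And>k. k \<in> K \<Longrightarrow> d \<le> q k"
  obtains p where "sublinear p" "\<And>x. p x \<le> q x" "\<And>k. k \<in> K \<Longrightarrow> p (- k) \<le> - d"
proof -
  define V where "V x = {q (x + t *\<^sub>R k) - t * d | t k. 0 \<le> t \<and> k \<in> K}" for x
  define p where "p x = Inf (V x)" for x
  have ne: "V x \<noteq> {}" for x
    using K(2) by (auto simp: V_def intro: exI[of _ "0::real"])
  \<comment> \<open>A lower bound free of \<open>t\<close> and \<open>k\<close> makes the infimum a
    genuine one; it rests on \<open>d\<close> being a lower bound of \<open>q\<close> on
    \<open>K\<close>.\<close>
  have low: "- q (- x) \<le> v" if "v \<in> V x" for v x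
  proof -
    obtain t k where tk: "v = q (x + t *\<^sub>R k) - t * d" "0 \<le> t" "k \<in> K"
      using \<open>v \<in> V x\<close> by (auto simp: V_def)
    have "t * d \<le> q (t *\<^sub>R k)"
      using tk d sublinear_scale[OF q] by (simp add: mult_left_mono)
    also have "\<dots> \<le> q (x + t *\<^sub>R k) + q (- x)"
      using sublinear_add[OF q, of "x + t *\<^sub>R k" "- x"] by simp
    finally show ?thesis using tk by simp
  qed
  have bdd: "bdd_below (V x)" for x
    using low by (auto simp: bdd_below_def)
  have le: "p x \<le> q (x + t *\<^sub>R k) - t * d" if "0 \<le> t" "k \<in> K" for x t k
    unfolding p_def using that by (intro cInf_lower bdd) (auto simp: V_def)
  have pq: "p x \<le> q x" for x
    using le[of 0 _ x] K(2) by auto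
  have "sublinear p"
  proof (rule sublinearI)
    fix x y
    have step: "p (x + y) \<le> v + w" if v: "v \<in> V x" and w: "w \<in> V y" for v w
    proof -
      obtain t k where tk: "v = q (x + t *\<^sub>R k) - t * d" "0 \<le> t" "k \<in> K"
        using v by (auto simp: V_def)
      obtain s l where sl: "w = q (y + s *\<^sub>R l) - s * d" "0 \<le> s" "l \<in> K"
        using w by (auto simp: V_def)
      \<comment> \<open>Convexity merges the two shifts into one multiple of a single point of
        \<open>K\<close>; with t = s = 0 there is nothing to normalise and any point will
        do.\<close>
      obtain m where m: "m \<in> K" "(t + s) *\<^sub>R m = t *\<^sub>R k + s *\<^sub>R l"
      proof (cases "t + s = 0")
        case True
        with tk sl have "t = 0" "s = 0" by auto
        with tk show ?thesis by (intro that[of k]) auto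
      next
        case False
        with tk sl have "0 < t + s" by simp
        then have "(t / (t + s)) *\<^sub>R k + (s / (t + s)) *\<^sub>R l \<in> K"
          using K(1) tk sl by (intro convexD) (auto simp: add_divide_distrib[symmetric])
        then show ?thesis
          using \<open>0 < t + s\<close> by (intro that) (auto simp: scaleR_add_right)
      qed
      have "p (x + y) \<le> q ((x + y) + (t + s) *\<^sub>R m) - (t + s) * d"
        using tk sl m by (intro le) auto
      also have "(x + y) + (t + s) *\<^sub>R m = (x + t *\<^sub>R k) + (y + s *\<^sub>R l)"
        using m by simp
      finally show ?thesis
        using sublinear_add[OF q, of "x + t *\<^sub>R k" "y + s *\<^sub>R l"] tk sl
        by (simp add: algebra_simps)
    qed
    have "p (x + y) - v \<le> p y" if "v \<in> V x" for v
      unfolding p_def[of y] by (rule cInf_greatest[OF ne]) (use step[OF that] in fastforce)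
    then have "p (x + y) - p y \<le> p x"
      unfolding p_def[of x] by (intro cInf_greatest[OF ne]) fastforce
    then show "p (x + y) \<le> p x + p y" by simp
  next
    fix t :: real and x assume t: "0 < t"
    have "inverse t * p (t *\<^sub>R x) \<le> p x"
      unfolding p_def[of x]
    proof (rule cInf_greatest[OF ne])
      fix v assume "v \<in> V x"
      then obtain s k where sk: "v = q (x + s *\<^sub>R k) - s * d" "0 \<le> s" "k \<in> K"
        by (auto simp: V_def)
      have "p (t *\<^sub>R x) \<le> q (t *\<^sub>R x + (t * s) *\<^sub>R k) - (t * s) * d"
        using sk t by (intro le) auto
      also have "t *\<^sub>R x + (t * s) *\<^sub>R k = t *\<^sub>R (x + s *\<^sub>R k)"
        by (simp add: scaleR_add_right)
      finally have "p (t *\<^sub>R x) \<le> t * v"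
        using sublinear_scale[OF q, of t "x + s *\<^sub>R k"] t sk by (simp add: right_diff_distrib mult.assoc)
      then show "inverse t * p (t *\<^sub>R x) \<le> v"
        using t by (simp add: field_simps)
    qed
    then show "p (t *\<^sub>R x) \<le> t * p x"
      using t by (simp add: field_simps)
  next
    have "0 \<le> p 0"
      unfolding p_def using low[of _ 0] sublinear_zero[OF q] by (intro cInf_greatest[OF ne]) auto
    then show "p 0 = 0"
      using pq[of 0] sublinear_zero[OF q] by simp
  qed
  moreover have "p (- k) \<le> - d" if "k \<in> K" for k
    using le[of 1 k "- k"] that sublinear_zero[OF q] by simp
  ultimately show ?thesis using pq that by blast
qed

text \<open>A pointwise minimal sublinear functional cannot be tilted any further, hence is linear.\<close>

lemma sublinear_dominates_linear:
  assumes p: "sublinear p"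
  obtains f where "linear f" "\<And>x. f x \<le> p x"
proof -
  define A where "A = {q. sublinear q \<and> (\<forall>x. q x \<le> p x)}"
  \<comment> \<open>The order is reversed, so that a maximal element for Zorn's lemma is pointwise
    minimal.\<close>
  define r where "r = {(q, q'). q \<in> A \<and> q' \<in> A \<and> q' \<le> q}"
  have Fr: "Field r = A"
    by (auto simp: r_def Field_def)
  have po: "Partial_order r"
    unfolding partial_order_on_def preorder_on_def Fr
    by (auto simp: r_def refl_on_def trans_def antisym_def intro: order_trans)
  have "\<exists>u\<in>Field r. \<forall>q\<in>C. (q, u) \<in> r" if C: "C \<in> Chains r" for C
  proof (cases "C = {}")
    case True
    then show ?thesis using p by (auto simp: Fr A_def)
  next
    case False
    have CA: "q \<in> A" if "q \<in> C" for q
      using C that by (auto simp: Chains_def r_def)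
    have tot: "q \<le> q' \<or> q' \<le> q" if "q \<in> C" "q' \<in> C" for q q'
      using C that by (auto simp: Chains_def r_def)
    \<comment> \<open>The bound of a non-empty chain is its pointwise infimum; the empty chain was
      bounded by \<open>p\<close> itself.\<close>
    define u where "u x = (INF q\<in>C. q x)" for x
    have bdd: "bdd_below ((\<lambda>q. q x) ` C)" for x
    proof (rule bdd_belowI2)
      fix q assume "q \<in> C"
      then have "sublinear q" "q (- x) \<le> p (- x)"
        using CA[of q] by (auto simp: A_def)
      then show "- p (- x) \<le> q x"
        using sublinear_lower[of q x] by linarith
    qed
    have ule: "u x \<le> q x" if "q \<in> C" for q x
      unfolding u_def using that bdd by (intro cINF_lower) auto
    have "sublinear u"
    proof (rule sublinearI)
      fix x y
      \<comment> \<open>Of two comparable members, the smaller one can be used at both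
        arguments.\<close>
      have step: "u (x + y) \<le> q x + q' y" if qq: "q \<in> C" "q' \<in> C" for q q'
        using tot[OF qq]
      proof
        assume "q \<le> q'"
        then have "q y \<le> q' y" by (simp add: le_fun_def)
        moreover have "q (x + y) \<le> q x + q y"
          using CA[OF qq(1)] sublinear_add[of q x y] by (simp add: A_def)
        ultimately show ?thesis
          using ule[OF qq(1), of "x + y"] by linarith
      next
        assume "q' \<le> q"
        then have "q' x \<le> q x" by (simp add: le_fun_def)
        moreover have "q' (x + y) \<le> q' x + q' y"
          using CA[OF qq(2)] sublinear_add[of q' x y] by (simp add: A_def)
        ultimately show ?thesis
          using ule[OF qq(2), of "x + y"] by linarith
      qed
      have "u (x + y) - q x \<le> u y" if "q \<in> C" for q
        unfolding u_def[of y] using step[OF that] False by (intro cINF_greatest) fastforce+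
      then have "u (x + y) - u y \<le> u x"
        unfolding u_def[of x] using False by (intro cINF_greatest) fastforce+
      then show "u (x + y) \<le> u x + u y" by simp
    next
      fix t :: real and x assume t: "0 < t"
      have "inverse t * u (t *\<^sub>R x) \<le> u x"
        unfolding u_def[of x]
      proof (rule cINF_greatest[OF False])
        fix q assume "q \<in> C"
        then have "u (t *\<^sub>R x) \<le> t * q x"
          using ule[of q "t *\<^sub>R x"] CA[of q] sublinear_scale[of q t x] t by (simp add: A_def)
        then show "inverse t * u (t *\<^sub>R x) \<le> q x"
          using t by (simp add: field_simps)
      qed
      then show "u (t *\<^sub>R x) \<le> t * u x"
        using t by (simp add: field_simps)
    next
      have "(\<lambda>q. q 0) ` C = {0}"
        using CA False sublinear_zero by (force simp: A_def)
      then show "u 0 = 0" by (simp add: u_def)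
    qed
    moreover have "u x \<le> p x" for x
    proof -
      obtain q where "q \<in> C" using False by blast
      then have "u x \<le> q x" "q x \<le> p x" using ule CA[of q] by (auto simp: A_def)
      then show ?thesis by linarith
    qed
    ultimately show ?thesis
      unfolding Fr using CA ule by (intro bexI[of _ u]) (auto simp: r_def A_def le_fun_def)
  qed
  from Zorns_po_lemma[OF po] this obtain q
    where qA: "q \<in> A" and qmin: "\<And>q'. q' \<in> A \<Longrightarrow> q' \<le> q \<Longrightarrow> q' = q"
    unfolding Fr by (force simp: r_def)
  have q: "sublinear q" and qp: "\<And>x. q x \<le> p x"
    using qA by (auto simp: A_def)
  \<comment> \<open>Tilting at the single point \<open>y\<close> with \<open>d = q y\<close> stays
    below \<open>q\<close>, so minimality makes the tilt equal to \<open>q\<close>. The resulting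
    oddness turns sublinearity into linearity.\<close>
  have neg: "q (- y) \<le> - q y" for y
  proof -
    obtain q' where q': "sublinear q'" "\<And>x. q' x \<le> q x" "\<And>k. k \<in> {y} \<Longrightarrow> q' (- k) \<le> - q y"
      using sublinear_tilt[OF q, of "{y}" "q y"] by auto
    have "q' \<in> A"
      using q' qp by (auto simp: A_def intro: order_trans)
    with qmin[of q'] q' show ?thesis
      by (auto simp: le_fun_def)
  qed
  have neg_eq: "q (- y) = - q y" for y
    using neg[of y] sublinear_lower[OF q, of y] by simp
  have "linear q"
  proof (rule linearI)
    fix x y
    show "q (x + y) = q x + q y"
      using sublinear_add[OF q, of x y] sublinear_add[OF q, of "- x" "- y"]
        neg_eq[of x] neg_eq[of y] neg_eq[of "x + y"] by simp
  next
    fix t :: real and x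
    show "q (t *\<^sub>R x) = t *\<^sub>R q x"
      using sublinear_scale[OF q, of t x] sublinear_scale[OF q, of "- t" x] neg_eq[of "t *\<^sub>R x"]
      by (cases "0 \<le> t") auto
  qed
  then show ?thesis using qp that by blast
qed

text \<open>As \<open>C\<close> misses a ball of radius \<open>d\<close> around \<open>x\<close>,
  the norm is at least \<open>d\<close> on x - C. Tilting the norm there and taking a linear
  functional below the tilt gives f(c - x) \<le> - d, while domination by the norm gives
  boundedness.\<close>

lemma separate_point_closed_convex:
  fixes x :: "'a::real_normed_vector"
  assumes C: "convex C" "closed C" "C \<noteq> {}" and x: "x \<notin> C"
  obtains f :: "'a \<Rightarrow> real" and d where "bounded_linear f" "0 < d" "\<And>c. c \<in> C \<Longrightarrow> f c + d \<le> f x"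
proof -
  define K where "K = (\<lambda>c. x - c) ` C"
  obtain d where d: "0 < d" "\<And>c. c \<in> C \<Longrightarrow> d \<le> dist x c"
  proof -
    obtain d where "0 < d" "ball x d \<subseteq> - C"
      using C(2) x open_contains_ball[of "- C"] by (auto simp: open_Compl)
    then show thesis
      by (intro that[of d]) (force simp: subset_iff)+
  qed
  have "sublinear (norm :: 'a \<Rightarrow> real)"
    by (auto simp: sublinear_def norm_triangle_ineq)
  moreover have "convex K"
    unfolding K_def using convex_translation[OF convex_negations[OF C(1)], of x]
    by (simp add: image_image)
  moreover have "K \<noteq> {}" "\<And>k. k \<in> K \<Longrightarrow> d \<le> norm k"
    using C d by (auto simp: K_def dist_norm)
  ultimately obtain p where p: "sublinear p" "\<And>z. p z \<le> norm z" "\<And>k. k \<in> K \<Longrightarrow> p (- k) \<le> - d"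
    using sublinear_tilt by blast
  obtain f where f: "linear f" "\<And>z. f z \<le> p z"
    using sublinear_dominates_linear[OF p(1)] by blast
  have "norm (f z) \<le> norm z * 1" for z
    using f(2)[of z] f(2)[of "- z"] p(2)[of z] p(2)[of "- z"] linear_neg[OF f(1), of z] by simp
  then have "bounded_linear f"
    using f(1) by (intro bounded_linear_intro[of f 1]) (auto simp: linear_add linear_scale)
  moreover have "f c + d \<le> f x" if "c \<in> C" for c
  proof -
    have "f (- (x - c)) \<le> - d"
      using f(2)[of "- (x - c)"] p(3)[of "x - c"] that by (force simp: K_def)
    then show ?thesis
      using linear_diff[OF f(1), of c x] by simp
  qed
  ultimately show ?thesis using d(1) that by blast
qed

section \<open>Lipschitz slices\<close>

text \<open>A step along u x + v y is a step along x followed by one along y. The second leg starts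
  elsewhere, hence \<open>W\<close> asks for the bound at all base points and all lengths.
  Continuity of \<open>g\<close> makes \<open>W\<close> closed.\<close>

lemma increment_bound_closed_convex_hull:
  fixes g :: "'a::real_normed_vector \<Rightarrow> real"
  assumes g: "continuous_on UNIV g"
    and A: "\<And>a p t. a \<in> A \<Longrightarrow> 0 < t \<Longrightarrow> g (p + t *\<^sub>R a) - g p \<le> \<alpha> * t"
    and w: "w \<in> closure (convex hull A)" and t: "0 \<le> t"
  shows "g (p + t *\<^sub>R w) - g p \<le> \<alpha> * t"
proof -
  define W where "W = {w. \<forall>p. \<forall>t\<ge>0. g (p + t *\<^sub>R w) - g p \<le> \<alpha> * t}"
  have "A \<subseteq> W"
  proof
    fix a assume "a \<in> A"
    have "g (p + t *\<^sub>R a) - g p \<le> \<alpha> * t" if "0 \<le> t" for p t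
      using A[OF \<open>a \<in> A\<close>, of t p] that by (cases "t = 0") auto
    then show "a \<in> W" by (simp add: W_def)
  qed
  moreover have "convex W"
    unfolding convex_def
  proof (intro ballI allI impI)
    fix x y and u v :: real
    assume xy: "x \<in> W" "y \<in> W" and uv: "0 \<le> u" "0 \<le> v" "u + v = 1"
    show "u *\<^sub>R x + v *\<^sub>R y \<in> W"
      unfolding W_def
    proof (intro CollectI allI impI)
      fix p and t :: real assume "0 \<le> t"
      have "g (p + (t * u) *\<^sub>R x) - g p \<le> \<alpha> * (t * u)"
        using xy uv \<open>0 \<le> t\<close> by (simp add: W_def)
      moreover have "g (p + (t * u) *\<^sub>R x + (t * v) *\<^sub>R y) - g (p + (t * u) *\<^sub>R x) \<le> \<alpha> * (t * v)"
        using xy uv \<open>0 \<le> t\<close> by (simp add: W_def)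
      ultimately have "g (p + (t * u) *\<^sub>R x + (t * v) *\<^sub>R y) - g p \<le> \<alpha> * t * (u + v)"
        by (simp add: algebra_simps)
      then show "g (p + t *\<^sub>R (u *\<^sub>R x + v *\<^sub>R y)) - g p \<le> \<alpha> * t"
        using uv by (simp add: scaleR_add_right add.assoc)
    qed
  qed
  moreover have "closed W"
    unfolding W_def
    by (intro closed_Collect_all closed_Collect_imp closed_Collect_le continuous_intros
        continuous_on_compose2[OF g]) auto
  ultimately have "closure (convex hull A) \<subseteq> W"
    by (intro closure_minimal hull_minimal)
  with w t show ?thesis by (auto simp: W_def)
qed

section \<open>The Lipschitz seminorm as a supremum\<close>

lemma lip_norm_upper:
  assumes "T \<in> Lip" "x1 \<noteq> x2"
  shows "norm (T x1 - T x2) / norm (x1 - x2) \<le> lip_norm T"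
  unfolding lip_norm_def
proof (rule cSup_upper)
  obtain L where "L-lipschitz_on UNIV T" using assms by (auto simp: Lip_def)
  then have "norm (T x - T y) / norm (x - y) \<le> L" if "x \<noteq> y" for x y
    using that lipschitz_onD[of L UNIV T x y] by (simp add: dist_norm field_simps)
  then show "bdd_above {norm (T x1 - T x2) / norm (x1 - x2) |x1 x2. x1 \<noteq> x2}"
    by (auto simp: bdd_above_def)
qed (use assms in auto)

lemma lip_norm_least:
  fixes T :: "'a::real_normed_vector \<Rightarrow> 'a"
  assumes "(UNIV :: 'a set) \<noteq> {0}"
    and "\<And>x1 x2. x1 \<noteq> x2 \<Longrightarrow> norm (T x1 - T x2) / norm (x1 - x2) \<le> L"
  shows "lip_norm T \<le> L"
proof -
  \<comment> \<open>A nonzero vector makes the set of difference quotients non-empty, as a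
    least-upper-bound argument for \<open>Sup\<close> requires.\<close>
  obtain x :: 'a where "x \<noteq> 0" using assms(1) by auto
  then show ?thesis
    unfolding lip_norm_def using assms(2) by (intro cSup_least) auto
qed

lemma Lip_id_plus: "T \<in> Lip \<Longrightarrow> (\<lambda>x. x + T x) \<in> Lip"
  unfolding Lip_def using lipschitz_on_add[OF lipschitz_on_id] by blast

section \<open>The Daugavet equation\<close>

text \<open>Lowering the weight of a unit vector from 1 to \<open>l i\<close> costs at most
  \<open>1 - l i\<close> in norm, so the total defect \<epsilon> does not grow.\<close>

lemma norm_add_sum_ge:
  fixes y :: "'i \<Rightarrow> 'a::real_normed_vector"
  assumes "finite I" "\<And>i. i \<in> I \<Longrightarrow> norm (y i) = 1" "\<And>i. i \<in> I \<Longrightarrow> 0 \<le> l i \<and> l i \<le> 1"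
    and "norm e + card I - \<epsilon> \<le> norm (e + (\<Sum>i\<in>I. y i))"
  shows "norm e + (\<Sum>i\<in>I. l i) - \<epsilon> \<le> norm (e + (\<Sum>i\<in>I. l i *\<^sub>R y i))"
proof -
  have "e + (\<Sum>i\<in>I. y i) = (e + (\<Sum>i\<in>I. l i *\<^sub>R y i)) + (\<Sum>i\<in>I. (1 - l i) *\<^sub>R y i)"
    by (simp add: scaleR_diff_left sum_subtractf)
  then have "norm (e + (\<Sum>i\<in>I. y i))
      \<le> norm (e + (\<Sum>i\<in>I. l i *\<^sub>R y i)) + norm (\<Sum>i\<in>I. (1 - l i) *\<^sub>R y i)"
    using norm_triangle_ineq by metis
  also have "norm (\<Sum>i\<in>I. (1 - l i) *\<^sub>R y i) \<le> (\<Sum>i\<in>I. 1 - l i)"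
    using assms(2,3) by (intro sum_norm_le) auto
  also have "\<dots> = card I - (\<Sum>i\<in>I. l i)"
    by (simp add: sum_subtractf)
  finally show ?thesis using assms(4) by simp
qed

lemma in_convex_hull_range:
  fixes b :: "nat \<Rightarrow> 'a::real_vector"
  assumes "c \<in> convex hull (range b)"
  obtains l :: "nat \<Rightarrow> real" and N where "\<And>i. 0 \<le> l i" "(\<Sum>i<N. l i) = 1" "c = (\<Sum>i<N. l i *\<^sub>R b i)"
proof -
  obtain S u where S: "finite S" "S \<subseteq> range b" "\<forall>x\<in>S. 0 \<le> u x" "sum u S = 1"
    "(\<Sum>v\<in>S. u v *\<^sub>R v) = c"
    using assms unfolding convex_hull_explicit by blast
  \<comment> \<open>\<open>b\<close> may repeat values; \<open>inv b\<close> selects one index for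
    each point of the combination, and all other indices get weight 0.\<close>
  define k where "k = inv b"
  have bk: "b (k v) = v" if "v \<in> S" for v
    using S(2) that by (auto simp: k_def f_inv_into_f)
  then have inj: "inj_on k S" by (metis inj_onI)
  define l where "l i = (if i \<in> k ` S then u (b i) else 0)" for i
  obtain N where N: "k ` S \<subseteq> {..<N}"
    using finite_nat_bounded[of "k ` S"] S(1) by auto
  have "(\<Sum>i<N. l i) = (\<Sum>i\<in>k ` S. l i)"
    using N by (intro sum.mono_neutral_right) (auto simp: l_def)
  also have "\<dots> = 1"
    using S bk by (simp add: sum.reindex[OF inj] l_def cong: sum.cong)
  finally have 1: "(\<Sum>i<N. l i) = 1" .
  have "(\<Sum>i<N. l i *\<^sub>R b i) = (\<Sum>i\<in>k ` S. l i *\<^sub>R b i)"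
    using N by (intro sum.mono_neutral_right) (auto simp: l_def)
  also have "\<dots> = c"
    using S bk by (simp add: sum.reindex[OF inj] l_def cong: sum.cong)
  finally have 2: "c = (\<Sum>i<N. l i *\<^sub>R b i)" by simp
  have "0 \<le> l i" for i
    using S bk by (auto simp: l_def)
  with 1 2 that show ?thesis by blast
qed

text \<open>Covers real and complex scalars at once; \<open>re\<close> is the real part on the ground field.\<close>

locale scalar_structure = vector_space sc
  for sc :: "'k::real_normed_field \<Rightarrow> 'a::real_normed_vector \<Rightarrow> 'a" +
  fixes re :: "'k \<Rightarrow> real"
  assumes sc_of_real: "sc (of_real r) x = r *\<^sub>R x"
    and norm_sc: "norm (sc c x) = norm c * norm x"
    and bounded_linear_re: "bounded_linear re"
    and re_of_real: "re (of_real r) = r"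
    and re_le_norm: "re c \<le> norm c"
    and rotation: "\<exists>u. norm u = 1 \<and> u * c = of_real (norm c)"
    and real_functional: "bounded_linear f \<Longrightarrow> \<exists>F\<in>dual_space sc. \<forall>x. re (F x) = f x"
begin

section \<open>Geometric form of the Daugavet property and its consequences for slopes\<close>

lemma rank_one_functional:
  assumes F: "F \<in> dual_space sc" "F \<noteq> (\<lambda>x. 0)" and v: "v \<noteq> 0"
  shows "bounded_operator sc (\<lambda>x. sc (F x) v)" "rank_one sc (\<lambda>x. sc (F x) v)"
proof -
  have bl: "bounded_linear F" and lin: "Vector_Spaces.linear sc (*) F"
    using F by (auto simp: dual_space_def)
  interpret F: bounded_linear F by fact
  have Fsc: "F (sc c x) = c * F x" for c x
  proof -
    interpret L: Vector_Spaces.linear sc "(*)" F by (rule lin)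
    show ?thesis by (rule L.scale)
  qed
  have scR: "sc (r *\<^sub>R c) v = r *\<^sub>R sc c v" for r c
    by (simp add: scaleR_conv_of_real scale_scale[symmetric] sc_of_real del: scale_scale)
  obtain K where K: "\<And>x. norm (F x) \<le> norm x * K"
    using F.bounded by blast
  have "bounded_linear (\<lambda>x. sc (F x) v)"
  proof (rule bounded_linear_intro[of _ "K * norm v"])
    fix x
    show "norm (sc (F x) v) \<le> norm x * (K * norm v)"
      using mult_right_mono[OF K[of x], of "norm v"] by (simp add: norm_sc mult.assoc)
  qed (auto simp: F.add F.scale scale_left_distrib scR)
  moreover have "Vector_Spaces.linear sc sc (\<lambda>x. sc (F x) v)"
    by unfold_locales (auto simp: F.add Fsc scale_left_distrib scale_right_distrib algebra_simps)
  ultimately show "bounded_operator sc (\<lambda>x. sc (F x) v)"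
    by (simp add: bounded_operator_def)
  obtain x0 where x0: "F x0 \<noteq> 0" using F by auto
  have "range (\<lambda>x. sc (F x) v) = span {v}"
  proof -
    have "sc c v \<in> range (\<lambda>x. sc (F x) v)" for c
      using x0 by (intro range_eqI[of _ _ "sc (c / F x0) x0"]) (simp add: Fsc)
    then show ?thesis by (auto simp: span_singleton)
  qed
  moreover have "dim (span {v}) = 1"
    using v by (simp add: dim_eq_card[of "{v}"] independent_insert)
  ultimately show "rank_one sc (\<lambda>x. sc (F x) v)"
    by (simp add: rank_one_def)
qed

text \<open>The rank-one operator \<open>R\<close> is scaled to have norm \<parallel>v\<parallel>. A
  point almost norming Id + R, normalised and rotated, gives a unit vector \<open>u\<close> with
  F(u) = c \<ge> 0 for which \<parallel>u + (c/M) v\<parallel> is almost 1 +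
  \<parallel>v\<parallel>. This forces \<open>c\<close> close to \<open>M\<close>, after which (c/M)
  v may be replaced by \<open>v\<close>.\<close>

lemma daugavet_slice_point:
  assumes D: "daugavet_property sc" and F: "F \<in> dual_space sc" "F \<noteq> (\<lambda>x. 0)"
    and v: "v \<noteq> 0" and e: "0 < e"
  obtains u where "norm u = 1" "1 + norm v - e < norm (u + v)" "onorm F - e < re (F u)"
proof -
  have bl: "bounded_linear F" and lin: "Vector_Spaces.linear sc (*) F"
    using F by (auto simp: dual_space_def)
  have Fsc: "F (sc c x) = c * F x" for c x
  proof -
    interpret L: Vector_Spaces.linear sc "(*)" F by (rule lin)
    show ?thesis by (rule L.scale)
  qed
  define M where "M = onorm F"
  have M: "0 < M"
    unfolding M_def using F bl by (simp add: onorm_pos_lt fun_eq_iff)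
  define v1 where "v1 = v /\<^sub>R M"
  define R where "R x = sc (F x) v1" for x
  have v1: "v1 \<noteq> 0" using v M by (simp add: v1_def)
  have nR: "norm (R x) = norm (F x) * (norm v / M)" for x
    using M by (simp add: R_def norm_sc v1_def divide_inverse mult.commute)
  have bR: "bounded_linear R" and oneR: "onorm (\<lambda>x. x + R x) = 1 + onorm R"
    using D rank_one_functional[OF F v1]
    by (auto simp: daugavet_property_def bounded_operator_def R_def[abs_def])
  have "onorm R = norm v"
  proof -
    have "onorm R = onorm (\<lambda>x. (norm v / M) *\<^sub>R F x)"
      unfolding onorm_def using nR M by (simp add: mult.commute)
    also have "\<dots> = norm v"
      using onorm_scaleR[OF bl, of "norm v / M"] M by (simp add: M_def[symmetric])
    finally show ?thesis .
  qed
  with oneR have sumR: "onorm (\<lambda>x. x + R x) = 1 + norm v" by simp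
  \<comment> \<open>One \<delta> is lost in almost norming and one in replacing (c/M) v by v, hence
    e / 2. The bound e \<parallel>v\<parallel> / M yields M - e < c, and \<delta> \<le> 1 keeps the
    constant in \<open>onorm_bound\<close> non-negative.\<close>
  define \<delta> where "\<delta> = min 1 (min (e / 2) (e * norm v / M))"
  have \<delta>: "0 < \<delta>" "2 * \<delta> \<le> e" "\<delta> \<le> e * norm v / M" "\<delta> \<le> 1"
      proof -
    show "0 < \<delta>" using e v M by (simp add: \<delta>_def)
    have "\<delta> \<le> e / 2" 
      unfolding \<delta>_def by (rule min.coboundedI2[OF min.cobounded1])
    then show "2 * \<delta> \<le> e" by simp
  qed (simp_all add: \<delta>_def)
  obtain x where x: "(1 + norm v - \<delta>) * norm x < norm (x + R x)"
  proof (rule ccontr)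
    assume "\<not> thesis"
    then have "norm (x + R x) \<le> (1 + norm v - \<delta>) * norm x" for x
      using that[of x] by force
    then have "onorm (\<lambda>x. x + R x) \<le> 1 + norm v - \<delta>"
      using \<delta>(4) norm_ge_zero[of v] by (intro onorm_bound) linarith+
    with sumR \<delta> show False by simp
  qed
  have "x \<noteq> 0"
    using x bR by (auto simp: linear_simps)
  \<comment> \<open>Multiplying by a scalar of modulus 1 makes the value of \<open>F\<close> real
    and non-negative; norms are unchanged because \<open>R\<close> is linear over the ground
    field.\<close>
  obtain w where w: "norm w = 1" "w * F x = of_real (norm (F x))"
    using rotation by blast
  define u where "u = sc w (x /\<^sub>R norm x)"
  have nu: "norm u = 1"
    using w \<open>x \<noteq> 0\<close> by (simp add: u_def norm_sc)
  define c where "c = norm (F x) / norm x"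
  have scR: "y /\<^sub>R norm x = sc (of_real (inverse (norm x))) y" for y
    by (simp add: sc_of_real del: of_real_inverse)
  have "F u = of_real c"
    using w by (simp add: u_def c_def Fsc scR divide_inverse mult.left_commute)
  have "c \<le> M"
    unfolding c_def M_def by (rule le_onorm[OF bl])
  have "u + (c / M) *\<^sub>R v = sc w ((x + R x) /\<^sub>R norm x)"
  proof -
    have "sc w (R x /\<^sub>R norm x) = sc (of_real c) v1"
      using w by (simp add: scR R_def c_def divide_inverse mult.left_commute mult.commute)
    also have "\<dots> = (c / M) *\<^sub>R v"
      by (simp add: sc_of_real v1_def divide_inverse)
    finally show ?thesis
      by (simp add: u_def scale_right_distrib scaleR_add_right)
  qed
  then have "norm (u + (c / M) *\<^sub>R v) = norm (x + R x) / norm x"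
    using w by (simp add: norm_sc divide_inverse mult.commute)
  then have big: "1 + norm v - \<delta> < norm (u + (c / M) *\<^sub>R v)"
    using x \<open>x \<noteq> 0\<close> by (simp add: pos_less_divide_eq)
  have c0: "0 \<le> c" by (simp add: c_def)
  then have "norm (u + (c / M) *\<^sub>R v) \<le> 1 + (c / M) * norm v"
    using norm_triangle_ineq[of u "(c / M) *\<^sub>R v"] nu M by simp
  with big have cv: "norm v - \<delta> < (c / M) * norm v" by simp
  have "norm (u + (c / M) *\<^sub>R v) \<le> norm (u + v) + (1 - c / M) * norm v"
  proof -
    have "u + (c / M) *\<^sub>R v = (u + v) - (1 - c / M) *\<^sub>R v"
      by (simp add: algebra_simps)
    then show ?thesis
      using norm_triangle_ineq4[of "u + v" "(1 - c / M) *\<^sub>R v"] M \<open>c \<le> M\<close>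
      by (simp add: add_diff_eq)
  qed
  with big cv \<delta> have 1: "1 + norm v - e < norm (u + v)"
    by (simp add: algebra_simps)
  have "norm v * M - \<delta> * M < c * norm v"
    using cv M by (simp add: field_simps)
  moreover have "\<delta> * M \<le> e * norm v"
    using \<delta>(3) M by (simp add: field_simps)
  ultimately have "(M - e) * norm v < c * norm v"
    by (simp add: algebra_simps)
  then have "M - e < c" using v by simp
  then have 2: "onorm F - e < re (F u)"
    using \<open>F u = of_real c\<close> by (simp add: re_of_real M_def)
  show ?thesis using that nu 1 2 by blast
qed

text \<open>A functional separating \<open>x\<close> from the hull would satisfy re F \<le>
  \<parallel>F\<parallel> - d on the generating set, but \<open>daugavet_slice_point\<close> yields
  a member of that set where re F exceeds \<parallel>F\<parallel> - d.\<close>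

lemma daugavet_closed_convex_hull:
  fixes x v :: 'a
  assumes D: "daugavet_property sc" and e: "0 < e" and x: "norm x = 1"
  shows "x \<in> closure (convex hull {y. norm y = 1 \<and> norm v + 1 - e < norm (v + y)})"
    (is "x \<in> closure (convex hull ?A)")
proof (rule ccontr)
  assume contr: "x \<notin> closure (convex hull ?A)"
  have pt: "\<exists>u\<in>?A. onorm F - d < re (F u)"
    if F: "F \<in> dual_space sc" "F \<noteq> (\<lambda>x. 0)" and d: "0 < d" for F d
  proof -
    have "0 < min d e" using d e by simp
    show ?thesis
    proof (cases "v = 0")
      \<comment> \<open>For v = 0 every unit vector belongs to the set; \<open>x\<close> stands in
        as the nonzero vector in the slice argument.\<close>
      case True
      have "x \<noteq> 0" using x by auto
      from daugavet_slice_point[OF D F this d] obtain u where "norm u = 1" "onorm F - d < re (F u)"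
        by blast
      with True e show ?thesis by auto
    next
      case False
      from daugavet_slice_point[OF D F this \<open>0 < min d e\<close>] obtain u
        where "norm u = 1" "1 + norm v - min d e < norm (u + v)" "onorm F - min d e < re (F u)"
        by blast
      then show ?thesis by (intro bexI[of _ u]) (auto simp: add.commute)
    qed
  qed
  have bounded_re: "re (F x) \<le> onorm F" if "F \<in> dual_space sc" for F
    using onorm[of F x] re_le_norm[of "F x"] that x by (auto simp: dual_space_def)
  \<comment> \<open>Separation needs a non-empty set. Separating \<open>x\<close> from 0 supplies a
    nonzero functional, and \<open>pt\<close> then supplies a member of \<open>?A\<close>.\<close>
  obtain f0 :: "'a \<Rightarrow> real" and d0
    where f0: "bounded_linear f0" "0 < d0" "\<And>c. c \<in> {0} \<Longrightarrow> f0 c + d0 \<le> f0 x"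
    by (rule separate_point_closed_convex[of "{0}" x]) (use x in auto)
  obtain F0 where F0: "F0 \<in> dual_space sc" "\<And>z. re (F0 z) = f0 z"
    using real_functional[OF f0(1)] by blast
  have re0: "re 0 = 0" using re_of_real[of 0] by simp
  have "F0 x \<noteq> 0"
    using f0 F0(2)[of x] re0 linear_simps(3)[OF f0(1)] by auto
  then have "?A \<noteq> {}"
    using pt[OF F0(1), of 1] by auto
  then have "closure (convex hull ?A) \<noteq> {}" by simp
  then obtain f :: "'a \<Rightarrow> real" and d
    where f: "bounded_linear f" "0 < d" "\<And>c. c \<in> closure (convex hull ?A) \<Longrightarrow> f c + d \<le> f x"
    by (rule separate_point_closed_convex
          [OF convex_closure[OF convex_convex_hull] closed_closure _ contr]) blast+
  have fA: "f a + d \<le> f x" if "a \<in> ?A" for a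
    by (rule f(3), rule subsetD[OF closure_subset], rule hull_inc[OF that])
  obtain F where F: "F \<in> dual_space sc" "\<And>z. re (F z) = f z"
    using real_functional[OF f(1)] by blast
  obtain a where "a \<in> ?A" using \<open>?A \<noteq> {}\<close> by blast
  have "F \<noteq> (\<lambda>x. 0)"
    using fA[OF \<open>a \<in> ?A\<close>] f(2) F(2)[of a] F(2)[of x] by auto
  from pt[OF F(1) this f(2)] obtain u where "u \<in> ?A" "onorm F - d < re (F u)" by blast
  with fA[of u] bounded_re[OF F(1)] F(2) show False by fastforce
qed

text \<open>If the increments of g = re F(T) had slope at most \<alpha> in all directions that
  nearly add up with \<open>v\<close>, the bound would pass to the closed convex hull of these
  directions, thus to every unit vector. A point of the slice contradicts this.\<close>

lemma slope_slice_direction: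
  fixes T :: "'a \<Rightarrow> 'a" and v :: 'a
  assumes D: "daugavet_property sc" and T: "continuous_on UNIV T"
    and S: "is_slice sc re (slope T) S" and e: "0 < e"
  obtains y p t where "norm y = 1" "norm v + 1 - e < norm (v + y)" "0 < t"
    "(T (p + t *\<^sub>R y) - T p) /\<^sub>R t \<in> S"
proof -
  obtain F \<alpha> where F: "F \<in> dual_space sc" and S_eq: "S = {x \<in> slope T. \<alpha> < re (F x)}" and "S \<noteq> {}"
    using S by (auto simp: is_slice_def)
  have bf: "bounded_linear (\<lambda>x. re (F x))"
    using F bounded_linear_compose[OF bounded_linear_re, of F] by (simp add: dual_space_def)
  define f where "f x = re (F x)" for x
  interpret f: bounded_linear f using bf by (simp add: f_def[abs_def])
  define g where "g x = f (T x)" for x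
  have g: "continuous_on UNIV g"
    unfolding g_def by (intro f.continuous_on T)
  obtain x1 x2 where x12: "x1 \<noteq> x2" "\<alpha> < f ((T x1 - T x2) /\<^sub>R norm (x1 - x2))"
    using \<open>S \<noteq> {}\<close> unfolding S_eq f_def slope_def by blast
  define r where "r = norm (x1 - x2)"
  have r: "0 < r" using x12 by (simp add: r_def)
  let ?A = "{y. norm y = 1 \<and> norm v + 1 - e < norm (v + y)}"
  let ?w = "(x1 - x2) /\<^sub>R r"
  have w: "?w \<in> closure (convex hull ?A)"
    using r by (intro daugavet_closed_convex_hull[OF D e]) (simp add: r_def)
  have "x2 + r *\<^sub>R ?w = x1" using r by simp
  moreover have "\<alpha> * r < g x1 - g x2"
    using x12(2) r by (simp add: r_def[symmetric] f.scale f.diff g_def field_simps)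
  ultimately have "\<not> g (x2 + r *\<^sub>R ?w) - g x2 \<le> \<alpha> * r" by simp
  then have "\<not> (\<forall>y p t. y \<in> ?A \<longrightarrow> 0 < t \<longrightarrow> g (p + t *\<^sub>R y) - g p \<le> \<alpha> * t)"
    using increment_bound_closed_convex_hull[OF g _ w, of \<alpha> r x2] r by (meson less_imp_le)
  then obtain y p t where ypt: "y \<in> ?A" "0 < t" "\<alpha> * t < g (p + t *\<^sub>R y) - g p"
    by (auto simp: not_le)
  let ?b = "(T (p + t *\<^sub>R y) - T p) /\<^sub>R t"
  have "?b \<in> slope T"
    unfolding slope_def using ypt by (intro CollectI exI[of _ "p + t *\<^sub>R y"] exI[of _ p]) auto
  moreover have "\<alpha> < f ?b"
    using ypt by (simp add: f.scale f.diff g_def field_simps)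
  ultimately have "?b \<in> S" by (simp add: S_eq f_def)
  with ypt that show ?thesis by blast
qed

text \<open>The defect \<epsilon> is uniform in \<open>N\<close>: the length of the convex
  combination becomes known only after the whole sequence has been chosen.\<close>

lemma nearly_additive_directions:
  fixes T :: "'a \<Rightarrow> 'a" and e :: 'a
  assumes D: "daugavet_property sc" and T: "continuous_on UNIV T"
    and S: "\<And>n. is_slice sc re (slope T) (S n)" and \<epsilon>: "0 < \<epsilon>"
  obtains y p :: "nat \<Rightarrow> 'a" and t :: "nat \<Rightarrow> real"
  where "\<And>n. norm (y n) = 1" "\<And>n. 0 < t n" "\<And>n. (T (p n + t n *\<^sub>R y n) - T (p n)) /\<^sub>R t n \<in> S n"
    "\<And>N. norm e + real N - \<epsilon> \<le> norm (e + (\<Sum>i<N. y i))"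
proof -
  have "\<forall>n v. \<exists>y p t. norm y = 1 \<and> norm v + 1 - \<epsilon> / 2 ^ Suc n < norm (v + y) \<and> 0 < t \<and>
      (T (p + t *\<^sub>R y) - T p) /\<^sub>R t \<in> S n"
  proof (intro allI)
    fix n v
    have "0 < \<epsilon> / 2 ^ Suc n" using \<epsilon> by simp
    from slope_slice_direction[OF D T S[of n] this, of v]
    show "\<exists>y p t. norm y = 1 \<and> norm v + 1 - \<epsilon> / 2 ^ Suc n < norm (v + y) \<and> 0 < t \<and>
        (T (p + t *\<^sub>R y) - T p) /\<^sub>R t \<in> S n"
      by metis
  qed
  then obtain Y P Q where YPQ: "\<And>n v. norm (Y n v) = 1"
      "\<And>n v. norm v + 1 - \<epsilon> / 2 ^ Suc n < norm (v + Y n v)" "\<And>n v. 0 < Q n v"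
      "\<And>n v. (T (P n v + Q n v *\<^sub>R Y n v) - T (P n v)) /\<^sub>R Q n v \<in> S n"
    unfolding choice_iff by blast
  \<comment> \<open>\<open>V n\<close> is \<open>e\<close> plus the first n directions. The next
    direction is chosen relative to this partial sum at a loss of \<epsilon> / 2^(n+1), and these
    losses sum to less than \<epsilon>.\<close>
  define V where "V = rec_nat e (\<lambda>n v. v + Y n v)"
  have V: "V 0 = e" "V (Suc n) = V n + Y n (V n)" for n
    by (auto simp: V_def)
  have Vsum: "V N = e + (\<Sum>i<N. Y i (V i))" for N
    by (induction N) (auto simp: V add.assoc)
  have Vnorm: "norm e + real N - \<epsilon> * (1 - 1 / 2 ^ N) \<le> norm (V N)" for N
  proof (induction N)
    case (Suc N)
    have "\<epsilon> * (1 - 1 / 2 ^ Suc N) = \<epsilon> * (1 - 1 / 2 ^ N) + \<epsilon> / 2 ^ Suc N"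
      by (simp add: field_simps)
    with Suc YPQ(2)[of "V N" N] show ?case by (simp add: V)
  qed (simp add: V)
  have "norm e + real N - \<epsilon> \<le> norm (e + (\<Sum>i<N. Y i (V i)))" for N
  proof -
    have "\<epsilon> * (1 - 1 / 2 ^ N) \<le> \<epsilon> * 1"
      using \<epsilon> by (intro mult_left_mono) auto
    with Vnorm[of N] show ?thesis by (simp add: Vsum[symmetric])
  qed
  with YPQ show ?thesis
    by (intro that[of "\<lambda>n. Y n (V n)" "\<lambda>n. Q n (V n)" "\<lambda>n. P n (V n)"]) auto
qed

lemma daugavet_equation_SCD:
  fixes T :: "'a \<Rightarrow> 'a"
  assumes nz: "(UNIV :: 'a set) \<noteq> {0}" and T: "T \<in> Lip"
    and D: "daugavet_property sc" and SCD: "SCD_set sc re (slope T)"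
  shows "lip_norm (\<lambda>x. x + T x) = 1 + lip_norm T"
proof (rule antisym)
  let ?G = "\<lambda>x. x + T x"
  show "lip_norm ?G \<le> 1 + lip_norm T"
  proof (rule lip_norm_least[OF nz])
    fix x1 x2 :: 'a assume ne: "x1 \<noteq> x2"
    have "norm (?G x1 - ?G x2) \<le> norm (x1 - x2) + norm (T x1 - T x2)"
      using norm_triangle_ineq[of "x1 - x2" "T x1 - T x2"] by (simp add: algebra_simps)
    then have "norm (?G x1 - ?G x2) / norm (x1 - x2) \<le> 1 + norm (T x1 - T x2) / norm (x1 - x2)"
      using ne by (simp add: field_simps)
    with lip_norm_upper[OF T ne] show "norm (?G x1 - ?G x2) / norm (x1 - x2) \<le> 1 + lip_norm T"
      by simp
  qed
  obtain L where "L-lipschitz_on UNIV T" using T by (auto simp: Lip_def)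
  then have cont: "continuous_on UNIV T" by (rule lipschitz_on_continuous_on)
  obtain S where S: "\<And>n. is_slice sc re (slope T) (S n)" and det: "determining (slope T) S"
    using SCD by (auto simp: SCD_set_def)
  \<comment> \<open>One \<epsilon> pays for the defect in additivity, the other for approximating
    \<open>e\<close> by a convex combination of the \<open>b n\<close>.\<close>
  have main: "norm e + 1 - 2 * \<epsilon> \<le> lip_norm ?G" if e: "e \<in> slope T" and \<epsilon>: "0 < \<epsilon>" for e \<epsilon>
  proof -
    obtain y p t where y: "\<And>n. norm (y n) = 1" and t: "\<And>n. 0 < t n"
      and bS': "\<And>n. (T (p n + t n *\<^sub>R y n) - T (p n)) /\<^sub>R t n \<in> S n"
      and sum_y: "\<And>N. norm e + real N - \<epsilon> \<le> norm (e + (\<Sum>i<N. y i))"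
      by (rule nearly_additive_directions[OF D cont S \<epsilon>, where e = e]) (rule that)
    define b where "b n = (T (p n + t n *\<^sub>R y n) - T (p n)) /\<^sub>R t n" for n
    have bS: "b n \<in> S n" for n using bS'[of n] by (simp add: b_def)
    have yb: "norm (y n + b n) \<le> lip_norm ?G" for n
    proof -
      have ne: "p n + t n *\<^sub>R y n \<noteq> p n" using y[of n] t[of n] by auto
      have "?G (p n + t n *\<^sub>R y n) - ?G (p n) = t n *\<^sub>R (y n + b n)"
        using t[of n] by (simp add: b_def scaleR_add_right)
      then show ?thesis
        using lip_norm_upper[OF Lip_id_plus[OF T] ne] y[of n] t[of n] by simp
    qed
    have "range b \<subseteq> slope T"
      using bS S by (fastforce simp: is_slice_def)
    moreover have "range b \<inter> S n \<noteq> {}" for n using bS by auto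
    ultimately have "slope T \<subseteq> closure (convex hull (range b))"
      using det by (simp add: determining_def)
    with e have "e \<in> closure (convex hull (range b))" by blast
    with \<epsilon> obtain c where c: "c \<in> convex hull (range b)" "dist c e < \<epsilon>"
      unfolding closure_approachable by blast
    obtain l N where l: "\<And>i. 0 \<le> l i" "(\<Sum>i<N. l i) = 1" and cl: "c = (\<Sum>i<N. l i *\<^sub>R b i)"
      using in_convex_hull_range[OF c(1)] by blast
    have "l i \<le> 1" if "i < N" for i
      using member_le_sum[of i "{..<N}" l] l that by simp
    then have "norm e + 1 - \<epsilon> \<le> norm (e + (\<Sum>i<N. l i *\<^sub>R y i))"
      using norm_add_sum_ge[of "{..<N}" y l e \<epsilon>] y l sum_y[of N] by simp
    \<comment> \<open>Exchanging \<open>e\<close> for the nearby \<open>c\<close> pairs each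
      direction with its difference quotient of \<open>T\<close>.\<close>
    also have "e + (\<Sum>i<N. l i *\<^sub>R y i) = (e - c) + (\<Sum>i<N. l i *\<^sub>R (y i + b i))"
      by (simp add: cl scaleR_add_right sum.distrib)
    also have "norm \<dots> \<le> norm (e - c) + norm (\<Sum>i<N. l i *\<^sub>R (y i + b i))"
      by (rule norm_triangle_ineq)
    also have "norm (\<Sum>i<N. l i *\<^sub>R (y i + b i)) \<le> (\<Sum>i<N. l i * lip_norm ?G)"
      using l yb by (intro sum_norm_le) (auto intro: mult_left_mono)
    also have "\<dots> = lip_norm ?G"
      using l by (simp add: sum_distrib_right[symmetric])
    finally show ?thesis using c(2) by (simp add: dist_norm norm_minus_commute)
  qed
  have "lip_norm T \<le> lip_norm ?G - 1"
  proof (rule lip_norm_least[OF nz])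
    fix x1 x2 :: 'a assume ne: "x1 \<noteq> x2"
    let ?e = "(T x1 - T x2) /\<^sub>R norm (x1 - x2)"
    have "?e \<in> slope T" using ne by (auto simp: slope_def)
    then have "norm ?e + 1 \<le> lip_norm ?G + \<epsilon>" if "0 < \<epsilon>" for \<epsilon>
      using main[of ?e "\<epsilon> / 2"] that by simp
    then have "norm ?e + 1 \<le> lip_norm ?G" by (rule field_le_epsilon)
    then show "norm (T x1 - T x2) / norm (x1 - x2) \<le> lip_norm ?G - 1"
      by (simp add: divide_inverse mult.commute)
  qed
  then show "1 + lip_norm T \<le> lip_norm ?G" by simp
qed

end

section \<open>Real and complex scalars as instances\<close>

lemma scalar_structure_real:
  "scalar_structure ((*\<^sub>R) :: real \<Rightarrow> 'a::real_normed_vector \<Rightarrow> 'a) (\<lambda>t. t)"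
proof (intro scalar_structure.intro scalar_structure_axioms.intro)
  fix c :: real
  show "\<exists>u. norm u = 1 \<and> u * c = of_real (norm c)"
    by (intro exI[of _ "if 0 \<le> c then 1 else - 1"]) auto
next
  fix f :: "'a \<Rightarrow> real" assume f: "bounded_linear f"
  have "Vector_Spaces.linear (*\<^sub>R) (*) f"
    using bounded_linear.linear[OF f] by (simp add: linear_def scaleR_conv_of_real[abs_def])
  with f show "\<exists>F\<in>dual_space (*\<^sub>R). \<forall>x. F x = f x"
    by (auto simp: dual_space_def)
qed (auto simp: bounded_linear_ident real_vector.vector_space_axioms)

lemma scalar_structure_complex:
  fixes sc :: "complex \<Rightarrow> 'a::real_normed_vector \<Rightarrow> 'a"
  assumes "complex_normed_space sc"
  shows "scalar_structure sc Re"
proof -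
  have vs: "vector_space sc" and scr: "\<And>r x. sc (complex_of_real r) x = r *\<^sub>R x"
    and nsc: "\<And>c x. norm (sc c x) = cmod c * norm x"
    using assms by (auto simp: complex_normed_space_def)
  interpret vector_space sc by (rule vs)
  show ?thesis
  proof (intro scalar_structure.intro scalar_structure_axioms.intro)
    fix c :: complex
    show "\<exists>u. norm u = 1 \<and> u * c = of_real (norm c)"
    proof (cases "c = 0")
      case False
      have "cnj c / norm c * c = norm c"
        using False complex_norm_square[of c] by (simp add: field_simps power2_eq_square)
      with False show ?thesis
        by (intro exI[of _ "cnj c / norm c"]) (simp add: norm_divide)
    qed (auto intro: exI[of _ 1])
  next
    fix f :: "'a \<Rightarrow> real" assume "bounded_linear f"
    then interpret f: bounded_linear f .
    \<comment> \<open>The usual complexification F(x) = f(x) - i f(i x), the only complex-linear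
      functional with real part \<open>f\<close>.\<close>
    define F where "F x = Complex (f x) (- f (sc \<i> x))" for x
    have comm: "sc c (r *\<^sub>R x) = r *\<^sub>R sc c x" for c r x
      by (simp add: scr[symmetric] mult.commute)
    have split: "sc c x = Re c *\<^sub>R x + Im c *\<^sub>R sc \<i> x" for c x
      by (subst complex_eq[of c]) (simp only: scale_left_distrib scr[symmetric] scale_scale mult.commute)
    have fsc: "f (sc c x) = Re c * f x + Im c * f (sc \<i> x)" for c x
      by (subst split) (simp add: f.add f.scale)
    have "Vector_Spaces.linear sc (*) F"
    proof
      fix x y c
      show "F (x + y) = F x + F y"
        by (simp add: F_def f.add scale_right_distrib complex_eq_iff)
      show "F (sc c x) = c * F x"
        \<comment> \<open>The instance at \<open>c\<close> gives the real part, the one at i c the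
          imaginary part.\<close>
        using fsc[of c x] fsc[of "\<i> * c" x] by (simp add: F_def complex_eq_iff)
    qed
    moreover obtain K where K: "\<And>x. norm (f x) \<le> norm x * K"
      using f.bounded by blast
    have "bounded_linear F"
    proof (rule bounded_linear_intro[of F "2 * K"])
      fix x y r
      show "F (x + y) = F x + F y"
        by (simp add: F_def f.add scale_right_distrib complex_eq_iff)
      show "F (r *\<^sub>R x) = r *\<^sub>R F x"
        by (simp add: F_def f.scale comm complex_eq_iff)
      show "norm (F x) \<le> norm x * (2 * K)"
        using cmod_le[of "F x"] K[of x] K[of "sc \<i> x"] by (simp add: F_def nsc)
    qed
    ultimately show "\<exists>F\<in>dual_space sc. \<forall>x. Re (F x) = f x"
      by (intro bexI[of _ F]) (auto simp: dual_space_def F_def)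
  qed (auto simp: vs scr nsc bounded_linear_Re complex_Re_le_cmod)
qed

theorem theorem3p4:
  fixes T :: "'a::banach \<Rightarrow> 'a"
  assumes "(UNIV :: 'a set) \<noteq> {0}"
    and "T \<in> Lip"
  shows "(daugavet_property ((*\<^sub>R) :: real \<Rightarrow> 'a \<Rightarrow> 'a) \<longrightarrow>
            SCD_set (*\<^sub>R) (\<lambda>t::real. t) (slope T) \<longrightarrow>
            lip_norm (\<lambda>x. x + T x) = 1 + lip_norm T) \<and>
         (\<forall>scaleC :: complex \<Rightarrow> 'a \<Rightarrow> 'a. complex_normed_space scaleC \<longrightarrow>
            daugavet_property scaleC \<longrightarrow>
            SCD_set scaleC Re (slope T) \<longrightarrow>
            lip_norm (\<lambda>x. x + T x) = 1 + lip_norm T)"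
  using scalar_structure.daugavet_equation_SCD[OF scalar_structure_real assms]
    scalar_structure.daugavet_equation_SCD[OF scalar_structure_complex assms]
  by blast

end
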